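(* Let $K$ be a field and let $L_{13}$ be the three-dimensional Leibniz algebra over $K$ with basis $\{e_1,e_2,e_3\}$ and nonzero products of basis elements $e_3e_3=e_1$, $e_1e_3=e_1+e_2$. If $K$ is infinite, then the $T$-ideal of polynomial identities of $L_{13}$ is generated by the polynomial $x_1(x_2x_3)$. If $K$ is finite with $|K|=q$, then the $T$-ideal $T(L_{13})$ is generated by the polynomials \[ x_1(x_2x_3)\qquad\text{and}\qquad x_1x_2^{(q)}-x_1x_2-x_2x_1^{(q)}+x_2x_1 . \]
   Context: A (right) Leibniz algebra over $K$ is a $K$-algebra satisfying $x(yz)=(xy)z-(xz)y$. Identities live in the free Leibniz algebra $\mathcal L\langle X\rangle$ over $K$ on $X=\{x_1,x_2,\dots\}$; $T(L)$ is the set of polynomials vanishing under all substitutions of elements of $L$. A $T$-ideal is an ideal invariant under all endomorphisms of $\mathcal L\langle X\rangle$, and it is generated by $S$ if it is the smallest $T$-ideal containing $S$. Products without brackets are left-normed, and $x_1x_2^{(q)}$ is $x_1$ multiplied on the right $q$ times successively by $x_2$. Products of basis elements not listed are zero. *)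

theory Defs
  imports Complex_Main "HOL-Library.Poly_Mapping" "HOL-Library.Product_Plus"
begin

locale nonassoc_algebra = vector_space scale
  for scale :: "'k::field \<Rightarrow> 'a::ab_group_add \<Rightarrow> 'a" +
  fixes mult :: "'a \<Rightarrow> 'a \<Rightarrow> 'a"
  assumes mult_add_left: "mult (x + y) z = mult x z + mult y z"
    and mult_add_right: "mult x (y + z) = mult x y + mult x z"
    and mult_scale_left: "mult (scale c x) y = scale c (mult x y)"
    and mult_scale_right: "mult x (scale c y) = scale c (mult x y)"
begin

definition ideal :: "'a set \<Rightarrow> bool" where
  "ideal I \<longleftrightarrow> subspace I \<and> (\<forall>a\<in>I. \<forall>x. mult x a \<in> I \<and> mult a x \<in> I)"

lemma mult_zero_left: "mult 0 y = 0"
  using mult_add_left[of 0 0 y] by simp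

lemma mult_zero_right: "mult x 0 = 0"
  using mult_add_right[of x 0 0] by simp

lemma mult_diff_left: "mult (x - y) z = mult x z - mult y z"
  using mult_add_left[of "x - y" y z] by simp

lemma mult_diff_right: "mult x (y - z) = mult x y - mult x z"
  using mult_add_right[of x "y - z" z] by simp

lemma mult_sum_left: "mult (sum f A) y = (\<Sum>a\<in>A. mult (f a) y)"
  by (induction A rule: infinite_finite_induct) (simp_all add: mult_zero_left mult_add_left)

lemma mult_sum_right: "mult x (sum f A) = (\<Sum>a\<in>A. mult x (f a))"
  by (induction A rule: infinite_finite_induct) (simp_all add: mult_zero_right mult_add_right)

end

locale leibniz_algebra = nonassoc_algebra +
  assumes leibniz: "mult x (mult y z) = mult (mult x y) z - mult (mult x z) y"

definition algebra_hom ::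
  "('k::field \<Rightarrow> 'a::ab_group_add \<Rightarrow> 'a) \<Rightarrow> ('a \<Rightarrow> 'a \<Rightarrow> 'a) \<Rightarrow>
   ('k \<Rightarrow> 'b::ab_group_add \<Rightarrow> 'b) \<Rightarrow> ('b \<Rightarrow> 'b \<Rightarrow> 'b) \<Rightarrow> ('a \<Rightarrow> 'b) \<Rightarrow> bool" where
  "algebra_hom s1 m1 s2 m2 h \<longleftrightarrow>
     Vector_Spaces.linear s1 s2 h \<and> (\<forall>x y. h (m1 x y) = m2 (h x) (h y))"

datatype 'x magma = Gen 'x | Mul "'x magma" "'x magma"

primrec magma_eval :: "('a \<Rightarrow> 'a \<Rightarrow> 'a) \<Rightarrow> ('x \<Rightarrow> 'a) \<Rightarrow> 'x magma \<Rightarrow> 'a" where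
  "magma_eval m \<phi> (Gen i) = \<phi> i"
| "magma_eval m \<phi> (Mul u v) = m (magma_eval m \<phi> u) (magma_eval m \<phi> v)"

type_synonym 'k nonassoc_poly = "nat magma \<Rightarrow>\<^sub>0 'k"

definition na_scale :: "'k::field \<Rightarrow> 'k nonassoc_poly \<Rightarrow> 'k nonassoc_poly" where
  "na_scale c f = Poly_Mapping.map ((*) c) f"

definition na_mult :: "'k::field nonassoc_poly \<Rightarrow> 'k nonassoc_poly \<Rightarrow> 'k nonassoc_poly" where
  "na_mult f g =
     (\<Sum>u\<in>Poly_Mapping.keys f. \<Sum>v\<in>Poly_Mapping.keys g.
        Poly_Mapping.single (Mul u v) (Poly_Mapping.lookup f u * Poly_Mapping.lookup g v))"

definition na_eval ::
  "('k::field \<Rightarrow> 'a::ab_group_add \<Rightarrow> 'a) \<Rightarrow> ('a \<Rightarrow> 'a \<Rightarrow> 'a) \<Rightarrow> (nat \<Rightarrow> 'a) \<Rightarrow>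
   'k nonassoc_poly \<Rightarrow> 'a" where
  "na_eval s m \<phi> f =
     (\<Sum>u\<in>Poly_Mapping.keys f. s (Poly_Mapping.lookup f u) (magma_eval m \<phi> u))"

lemma lookup_na_scale: "Poly_Mapping.lookup (na_scale c f) u = c * Poly_Mapping.lookup f u"
  by (simp add: na_scale_def Poly_Mapping.map.rep_eq when_def)

lemma na_scale_single: "na_scale c (Poly_Mapping.single u a) = Poly_Mapping.single u (c * a)"
  by (rule poly_mapping_eqI) (simp add: lookup_na_scale lookup_single when_def)

interpretation na: vector_space na_scale
  by unfold_locales
    (rule poly_mapping_eqI, simp add: lookup_na_scale lookup_add algebra_simps)+

lemma na_mult_superset:
  assumes "finite A" "finite B" "Poly_Mapping.keys f \<subseteq> A" "Poly_Mapping.keys g \<subseteq> B"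
  shows "na_mult f g =
    (\<Sum>u\<in>A. \<Sum>v\<in>B.
       Poly_Mapping.single (Mul u v) (Poly_Mapping.lookup f u * Poly_Mapping.lookup g v))"
proof -
  have "na_mult f g = (\<Sum>u\<in>Poly_Mapping.keys f. \<Sum>v\<in>B.
       Poly_Mapping.single (Mul u v) (Poly_Mapping.lookup f u * Poly_Mapping.lookup g v))"
    unfolding na_mult_def
    by (intro sum.cong sum.mono_neutral_left refl assms) (auto simp: in_keys_iff)
  also have "\<dots> = (\<Sum>u\<in>A. \<Sum>v\<in>B.
       Poly_Mapping.single (Mul u v) (Poly_Mapping.lookup f u * Poly_Mapping.lookup g v))"
    by (intro sum.mono_neutral_left assms) (auto simp: in_keys_iff)
  finally show ?thesis .
qed

lemma na_eval_superset:
  assumes "vector_space s" "finite A" "Poly_Mapping.keys f \<subseteq> A"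
  shows "na_eval s m \<phi> f = (\<Sum>u\<in>A. s (Poly_Mapping.lookup f u) (magma_eval m \<phi> u))"
proof -
  interpret vector_space s by fact
  show ?thesis
    unfolding na_eval_def
    by (intro sum.mono_neutral_left assms) (auto simp: in_keys_iff)
qed

lemma keys_na_scale_subset: "Poly_Mapping.keys (na_scale c f) \<subseteq> Poly_Mapping.keys f"
  by (auto simp: in_keys_iff lookup_na_scale)

interpretation na: nonassoc_algebra "na_scale :: 'k::field \<Rightarrow> _" na_mult
proof unfold_locales
  fix f g h :: "'k nonassoc_poly"
  let ?A = "Poly_Mapping.keys f \<union> Poly_Mapping.keys g \<union> Poly_Mapping.keys h"
  have A: "finite ?A" by simp
  have fg: "Poly_Mapping.keys (f + g) \<subseteq> ?A" "Poly_Mapping.keys (g + h) \<subseteq> ?A"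
    using keys_add[of f g] keys_add[of g h] by blast+
  have sub: "Poly_Mapping.keys f \<subseteq> ?A" "Poly_Mapping.keys g \<subseteq> ?A" "Poly_Mapping.keys h \<subseteq> ?A"
    by auto
  note ss = na_mult_superset[OF A A]
  show "na_mult (f + g) h = na_mult f h + na_mult g h"
    using fg sub
    by (simp add: ss lookup_add distrib_right single_add sum.distrib)
  show "na_mult f (g + h) = na_mult f g + na_mult f h"
    using fg sub
    by (simp add: ss lookup_add distrib_left single_add sum.distrib)
next
  fix c :: 'k and f g :: "'k nonassoc_poly"
  let ?A = "Poly_Mapping.keys f \<union> Poly_Mapping.keys g"
  have A: "finite ?A" by simp
  have sub: "Poly_Mapping.keys f \<subseteq> ?A" "Poly_Mapping.keys g \<subseteq> ?A"
    "Poly_Mapping.keys (na_scale c f) \<subseteq> ?A" "Poly_Mapping.keys (na_scale c g) \<subseteq> ?A"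
    using keys_na_scale_subset by blast+
  note ss = na_mult_superset[OF A A]
  show "na_mult (na_scale c f) g = na_scale c (na_mult f g)"
    using sub
    by (simp add: ss lookup_na_scale na.scale_sum_right na_scale_single mult.assoc)
  show "na_mult f (na_scale c g) = na_scale c (na_mult f g)"
    using sub
    by (simp add: ss lookup_na_scale na.scale_sum_right na_scale_single algebra_simps)
qed

lemma na_mult_single:
  "na_mult (Poly_Mapping.single u a) (Poly_Mapping.single v b) =
   Poly_Mapping.single (Mul u v) (a * b)"
proof -
  have "na_mult (Poly_Mapping.single u a) (Poly_Mapping.single v b) =
    (\<Sum>u'\<in>{u}. \<Sum>v'\<in>{v}. Poly_Mapping.single (Mul u' v')
       (Poly_Mapping.lookup (Poly_Mapping.single u a) u' *
        Poly_Mapping.lookup (Poly_Mapping.single v b) v'))"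
    by (rule na_mult_superset) auto
  then show ?thesis by simp
qed

lemma na_poly_sum:
  "f = (\<Sum>u\<in>Poly_Mapping.keys f. na_scale (Poly_Mapping.lookup f u) (Poly_Mapping.single u 1))"
proof (rule poly_mapping_eqI)
  fix w
  show "Poly_Mapping.lookup f w = Poly_Mapping.lookup (\<Sum>u\<in>Poly_Mapping.keys f.
      na_scale (Poly_Mapping.lookup f u) (Poly_Mapping.single u 1)) w"
    by (simp add: lookup_sum lookup_na_scale lookup_single when_def in_keys_iff
        if_distrib sum.delta cong: if_cong)
qed

context nonassoc_algebra
begin

lemma na_eval_add: "na_eval scale mult \<phi> (f + g) = na_eval scale mult \<phi> f + na_eval scale mult \<phi> g"
proof -
  let ?A = "Poly_Mapping.keys f \<union> Poly_Mapping.keys g"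
  have A: "finite ?A" by simp
  note ss = na_eval_superset[OF vector_space_axioms A]
  show ?thesis
    using keys_add[of f g] by (simp add: ss lookup_add scale_left_distrib sum.distrib)
qed

lemma na_eval_scale: "na_eval scale mult \<phi> (na_scale c f) = scale c (na_eval scale mult \<phi> f)"
  using na_eval_superset[OF vector_space_axioms finite_keys keys_na_scale_subset[of c f]]
  by (simp add: na_eval_def lookup_na_scale scale_sum_right)

lemma na_eval_single:
  "na_eval scale mult \<phi> (Poly_Mapping.single u a) = scale a (magma_eval mult \<phi> u)"
  using na_eval_superset[OF vector_space_axioms, of "{u}" "Poly_Mapping.single u a"]
  by simp

lemma na_eval_zero: "na_eval scale mult \<phi> 0 = 0"
  by (simp add: na_eval_def)

lemma na_eval_diff: "na_eval scale mult \<phi> (f - g) = na_eval scale mult \<phi> f - na_eval scale mult \<phi> g"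
  using na_eval_add[of \<phi> "f - g" g] by simp

lemma na_eval_sum: "na_eval scale mult \<phi> (sum F A) = (\<Sum>a\<in>A. na_eval scale mult \<phi> (F a))"
  by (induction A rule: infinite_finite_induct) (simp_all add: na_eval_zero na_eval_add)

lemma na_eval_mult:
  "na_eval scale mult \<phi> (na_mult f g) = mult (na_eval scale mult \<phi> f) (na_eval scale mult \<phi> g)"
proof -
  have "na_eval scale mult \<phi> (na_mult f g) =
    (\<Sum>u\<in>Poly_Mapping.keys f. \<Sum>v\<in>Poly_Mapping.keys g.
       scale (Poly_Mapping.lookup f u * Poly_Mapping.lookup g v)
         (mult (magma_eval mult \<phi> u) (magma_eval mult \<phi> v)))"
    by (simp only: na_mult_def na_eval_sum na_eval_single magma_eval.simps)
  also have "\<dots> = mult (na_eval scale mult \<phi> f) (na_eval scale mult \<phi> g)"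
    unfolding na_eval_def mult_sum_left
    by (simp add: mult_sum_right mult_scale_left mult_scale_right scale_sum_right mult.commute)
  finally show ?thesis .
qed

end

text \<open>The quotient of the free nonassociative algebra by the ideal generated by all
  instances of the (right) Leibniz identity.\<close>

definition leibniz_ideal :: "'k::field nonassoc_poly set" where
  "leibniz_ideal = \<Inter>{I. na.ideal I \<and>
     (\<forall>f g h. na_mult f (na_mult g h) - (na_mult (na_mult f g) h - na_mult (na_mult f h) g) \<in> I)}"

lemma leibniz_ideal_ideal: "na.ideal leibniz_ideal"
  unfolding leibniz_ideal_def na.ideal_def na.subspace_def by blast

lemma leibniz_ideal_leibniz:
  "na_mult f (na_mult g h) - (na_mult (na_mult f g) h - na_mult (na_mult f h) g) \<in> leibniz_ideal"
  unfolding leibniz_ideal_def by blast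

lemma leibniz_ideal_least:
  assumes "na.ideal I"
    and "\<And>f g h. na_mult f (na_mult g h) - (na_mult (na_mult f g) h - na_mult (na_mult f h) g) \<in> I"
  shows "leibniz_ideal \<subseteq> I"
  using assms unfolding leibniz_ideal_def by blast

lemma leibniz_subspace: "na.subspace leibniz_ideal"
  by (rule leibniz_ideal_ideal[unfolded na.ideal_def, THEN conjunct1])

lemma leibniz_ideal_mult:
  assumes "a \<in> leibniz_ideal"
  shows "na_mult x a \<in> leibniz_ideal" and "na_mult a x \<in> leibniz_ideal"
  using leibniz_ideal_ideal[unfolded na.ideal_def, THEN conjunct2] assms by blast+

quotient_type (overloaded) 'k free_leibniz =
  "nat magma \<Rightarrow>\<^sub>0 'k::field" / "\<lambda>f g. f - g \<in> leibniz_ideal"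
proof (rule equivpI)
  show "reflp (\<lambda>f g. f - g \<in> (leibniz_ideal :: 'k nonassoc_poly set))"
    by (rule reflpI) (simp add: na.subspace_0[OF leibniz_subspace])
  show "symp (\<lambda>f g. f - g \<in> (leibniz_ideal :: 'k nonassoc_poly set))"
  proof (rule sympI)
    fix f g :: "'k nonassoc_poly"
    assume "f - g \<in> leibniz_ideal"
    then show "g - f \<in> leibniz_ideal"
      using na.subspace_neg[OF leibniz_subspace, of "f - g"] by simp
  qed
  show "transp (\<lambda>f g. f - g \<in> (leibniz_ideal :: 'k nonassoc_poly set))"
  proof (rule transpI)
    fix f g h :: "'k nonassoc_poly"
    assume "f - g \<in> leibniz_ideal" "g - h \<in> leibniz_ideal"
    then show "f - h \<in> leibniz_ideal"
      using na.subspace_add[OF leibniz_subspace, of "f - g" "g - h"] by simp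
  qed
qed

instantiation free_leibniz :: (field) ab_group_add
begin

lift_definition zero_free_leibniz :: "'a free_leibniz" is 0 .

lift_definition plus_free_leibniz :: "'a free_leibniz \<Rightarrow> 'a free_leibniz \<Rightarrow> 'a free_leibniz" is "(+)"
  by (metis add_diff_add na.subspace_add[OF leibniz_subspace])

lift_definition minus_free_leibniz :: "'a free_leibniz \<Rightarrow> 'a free_leibniz \<Rightarrow> 'a free_leibniz" is "(-)"
proof -
  fix f f' g g' :: "'a nonassoc_poly"
  assume "f - f' \<in> leibniz_ideal" "g - g' \<in> leibniz_ideal"
  moreover have "f - g - (f' - g') = (f - f') - (g - g')" by simp
  ultimately show "f - g - (f' - g') \<in> leibniz_ideal"
    by (metis na.subspace_diff[OF leibniz_subspace])
qed

lift_definition uminus_free_leibniz :: "'a free_leibniz \<Rightarrow> 'a free_leibniz" is uminus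
  by (metis minus_diff_commute minus_diff_eq diff_minus_eq_add na.subspace_neg[OF leibniz_subspace]
      add.commute uminus_add_conv_diff)

instance
  by standard (transfer, simp add: na.subspace_0[OF leibniz_subspace] algebra_simps)+

end

instantiation free_leibniz :: (field) times
begin

lift_definition times_free_leibniz :: "'a free_leibniz \<Rightarrow> 'a free_leibniz \<Rightarrow> 'a free_leibniz"
  is na_mult
proof -
  fix f f' g g' :: "'a nonassoc_poly"
  assume a: "f - f' \<in> leibniz_ideal" "g - g' \<in> leibniz_ideal"
  have "na_mult f g - na_mult f' g' = na_mult (f - f') g + na_mult f' (g - g')"
    by (simp add: na.mult_diff_left na.mult_diff_right)
  then show "na_mult f g - na_mult f' g' \<in> leibniz_ideal"
    using a by (simp add: leibniz_ideal_mult na.subspace_add[OF leibniz_subspace])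
qed

instance ..

end

lift_definition fl_scale :: "'k::field \<Rightarrow> 'k free_leibniz \<Rightarrow> 'k free_leibniz" is na_scale
  by (metis na.scale_right_diff_distrib na.subspace_scale[OF leibniz_subspace])

text \<open>The variables \<open>x\<^sub>1, x\<^sub>2, x\<^sub>3, \<dots>\<close> are \<open>var 0, var 1, var 2, \<dots>\<close>.\<close>

lift_definition var :: "nat \<Rightarrow> 'k::field free_leibniz" is "\<lambda>i. Poly_Mapping.single (Gen i) 1" .

interpretation fl: leibniz_algebra fl_scale "(*)"
proof (unfold_locales, goal_cases)
  case 1 show ?case
    by (transfer, simp add: na.scale_right_distrib na.subspace_0[OF leibniz_subspace])
next
  case 2 show ?case
    by (transfer, simp add: na.scale_left_distrib na.subspace_0[OF leibniz_subspace])
next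
  case 3 show ?case
    by (transfer, simp add: na.subspace_0[OF leibniz_subspace])
next
  case 4 show ?case
    by (transfer, simp add: na.subspace_0[OF leibniz_subspace])
next
  case 5 show ?case
    by (transfer, simp add: na.mult_add_left na.subspace_0[OF leibniz_subspace])
next
  case 6 show ?case
    by (transfer, simp add: na.mult_add_right na.subspace_0[OF leibniz_subspace])
next
  case 7 show ?case
    by (transfer, simp add: na.mult_scale_left na.subspace_0[OF leibniz_subspace])
next
  case 8 show ?case
    by (transfer, simp add: na.mult_scale_right na.subspace_0[OF leibniz_subspace])
next
  case 9 show ?case
    by (transfer, rule leibniz_ideal_leibniz)
qed

text \<open>The value of a polynomial under the substitution \<open>\<phi>\<close> is computed on a chosen representative.
  It does not depend on that choice when the target is a Leibniz algebra, in which case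
  \<open>fl_eval s m \<phi>\<close> is the unique homomorphism with \<open>var i \<mapsto> \<phi> i\<close>; see below.\<close>

definition fl_eval ::
  "('k::field \<Rightarrow> 'a::ab_group_add \<Rightarrow> 'a) \<Rightarrow> ('a \<Rightarrow> 'a \<Rightarrow> 'a) \<Rightarrow> (nat \<Rightarrow> 'a) \<Rightarrow>
   'k free_leibniz \<Rightarrow> 'a" where
  "fl_eval s m \<phi> f = na_eval s m \<phi> (rep_free_leibniz f)"

definition T_of ::
  "('k::field \<Rightarrow> 'a::ab_group_add \<Rightarrow> 'a) \<Rightarrow> ('a \<Rightarrow> 'a \<Rightarrow> 'a) \<Rightarrow> 'k free_leibniz set" where
  "T_of s m = {f. \<forall>\<phi>. fl_eval s m \<phi> f = 0}"

context leibniz_algebra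
begin

lemma na_eval_leibniz_ideal:
  assumes "f \<in> leibniz_ideal"
  shows "na_eval scale mult \<phi> f = 0"
proof -
  have "leibniz_ideal \<subseteq> {f. na_eval scale mult \<phi> f = 0}"
    by (rule leibniz_ideal_least)
      (auto simp: na.ideal_def na.subspace_def na_eval_zero na_eval_add na_eval_scale
        na_eval_diff na_eval_mult mult_zero_left mult_zero_right leibniz)
  then show ?thesis using assms by blast
qed

lemma fl_eval_abs: "fl_eval scale mult \<phi> (abs_free_leibniz f) = na_eval scale mult \<phi> f"
proof -
  have "rep_free_leibniz (abs_free_leibniz f) - f \<in> leibniz_ideal"
    by (rule Quotient3_rep_abs[OF Quotient3_free_leibniz])
      (simp add: na.subspace_0[OF leibniz_subspace])
  then show ?thesis
    using na_eval_leibniz_ideal[of _ \<phi>] by (fastforce simp: fl_eval_def na_eval_diff)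
qed

lemma fl_eval_var: "fl_eval scale mult \<phi> (var i) = \<phi> i"
  by (simp add: var.abs_eq fl_eval_abs na_eval_single)

lemma fl_eval_add: "fl_eval scale mult \<phi> (f + g) = fl_eval scale mult \<phi> f + fl_eval scale mult \<phi> g"
  by (induction f, induction g) (simp add: plus_free_leibniz.abs_eq fl_eval_abs na_eval_add)

lemma fl_eval_scale: "fl_eval scale mult \<phi> (fl_scale c f) = scale c (fl_eval scale mult \<phi> f)"
  by (induction f) (simp add: fl_scale.abs_eq fl_eval_abs na_eval_scale)

lemma fl_eval_mult: "fl_eval scale mult \<phi> (f * g) = mult (fl_eval scale mult \<phi> f) (fl_eval scale mult \<phi> g)"
  by (induction f, induction g) (simp add: times_free_leibniz.abs_eq fl_eval_abs na_eval_mult)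

lemma fl_eval_hom: "algebra_hom fl_scale (*) scale mult (fl_eval scale mult \<phi>)"
  unfolding algebra_hom_def
  by (intro conjI allI fl_eval_mult)
    (unfold_locales; simp add: fl_eval_add fl_eval_scale)

end

text \<open>\<open>T_ideal_generated S J\<close>: the T-ideal generated by \<open>S\<close> is \<open>J\<close>.\<close>

definition T_ideal :: "'k::field free_leibniz set \<Rightarrow> bool" where
  "T_ideal J \<longleftrightarrow> fl.ideal J \<and> (\<forall>h. algebra_hom fl_scale (*) fl_scale (*) h \<longrightarrow> h ` J \<subseteq> J)"

definition T_ideal_generated :: "'k::field free_leibniz set \<Rightarrow> 'k free_leibniz set \<Rightarrow> bool" where
  "T_ideal_generated S J \<longleftrightarrow>
     T_ideal J \<and> S \<subseteq> J \<and> (\<forall>J'. T_ideal J' \<and> S \<subseteq> J' \<longrightarrow> J \<subseteq> J')"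

lemma abs_single_magma_eval:
  "abs_free_leibniz (Poly_Mapping.single u 1) = magma_eval (*) var u"
proof (induction u)
  case (Gen i)
  then show ?case by (simp add: var.abs_eq)
next
  case (Mul u v)
  then show ?case
    by (simp flip: Mul.IH add: times_free_leibniz.abs_eq na_mult_single)
qed

lemma fl_eval_unique:
  assumes h: "algebra_hom fl_scale (*) s m h" and var: "\<And>i. h (var i) = \<phi> i"
  shows "h f = fl_eval s m \<phi> f"
proof -
  have lin: "Vector_Spaces.linear fl_scale s h" and hm: "\<And>x y. h (x * y) = m (h x) (h y)"
    using h by (auto simp: algebra_hom_def)
  interpret Vector_Spaces.linear fl_scale s h by (fact lin)
  have hw: "h (magma_eval (*) var u) = magma_eval m \<phi> u" for u
    by (induction u) (simp_all add: var hm)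
  define r where "r = rep_free_leibniz f"
  have abs_sum: "abs_free_leibniz (sum F A) = (\<Sum>a\<in>A. abs_free_leibniz (F a))"
    for F :: "nat magma \<Rightarrow> _" and A
    by (induction A rule: infinite_finite_induct)
      (simp_all add: zero_free_leibniz.abs_eq flip: plus_free_leibniz.abs_eq)
  have "f = abs_free_leibniz r"
    by (simp add: r_def Quotient3_abs_rep[OF Quotient3_free_leibniz])
  also have "\<dots> = (\<Sum>u\<in>Poly_Mapping.keys r.
      fl_scale (Poly_Mapping.lookup r u) (magma_eval (*) var u))"
    by (subst na_poly_sum[of r])
      (simp add: abs_sum fl_scale.abs_eq flip: abs_single_magma_eval)
  finally have "h f = (\<Sum>u\<in>Poly_Mapping.keys r. s (Poly_Mapping.lookup r u) (magma_eval m \<phi> u))"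
    by (simp add: sum scale hw)
  then show ?thesis by (simp add: fl_eval_def na_eval_def r_def)
qed

definition rmult_pow :: "'k::field free_leibniz \<Rightarrow> 'k free_leibniz \<Rightarrow> nat \<Rightarrow> 'k free_leibniz" where
  "rmult_pow f g q = ((\<lambda>h. h * g) ^^ q) f"

locale leibniz_L13 = leibniz_algebra scale mult
  for scale :: "'k::field \<Rightarrow> 'a::ab_group_add \<Rightarrow> 'a" and mult :: "'a \<Rightarrow> 'a \<Rightarrow> 'a" +
  fixes e1 e2 e3 :: 'a
  assumes distinct_basis: "distinct [e1, e2, e3]"
    and independent_basis: "independent {e1, e2, e3}"
    and span_basis: "span {e1, e2, e3} = UNIV"
    and e33: "mult e3 e3 = e1"
    and e13: "mult e1 e3 = e1 + e2"
    and e11: "mult e1 e1 = 0" and e12: "mult e1 e2 = 0"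
    and e21: "mult e2 e1 = 0" and e22: "mult e2 e2 = 0" and e23: "mult e2 e3 = 0"
    and e31: "mult e3 e1 = 0" and e32: "mult e3 e2 = 0"

lemma leibniz_L13_exists:
  "leibniz_L13 (\<lambda>(c::'k::field) (x, y, z). (c * x, c * y, c * z))
     (\<lambda>(x, y, z) (x', y', z'). ((z + x) * z', x * z', 0))
     (1, 0, 0) (0, 1, 0) (0, 0, 1)"
    (is "leibniz_L13 ?s ?m ?e1 ?e2 ?e3")
proof -
  interpret V: leibniz_algebra ?s ?m
    by unfold_locales (auto simp: algebra_simps split: prod.splits)
  have sp: "v \<in> V.span {?e1, ?e2, ?e3}" for v
  proof -
    obtain a b c where v: "v = (a, b, c)" by (cases v) auto
    have "v = ?s a ?e1 + (?s b ?e2 + ?s c ?e3)" by (simp add: v)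
    also have "\<dots> \<in> V.span {?e1, ?e2, ?e3}"
      by (intro V.span_add V.span_scale V.span_base) auto
    finally show ?thesis .
  qed
  have ind: "V.independent {?e1, ?e2, ?e3}"
  proof (rule V.independent_if_scalars_zero)
    fix f :: "'k \<times> 'k \<times> 'k \<Rightarrow> 'k" and x
    assume "(\<Sum>x\<in>{?e1, ?e2, ?e3}. ?s (f x) x) = 0" "x \<in> {?e1, ?e2, ?e3}"
    then show "f x = 0" by (auto simp: zero_prod_def)
  qed simp
  show ?thesis
    by unfold_locales (use sp ind in \<open>auto simp: zero_prod_def\<close>)
qed

end

theory Submission
  imports Defs "HOL-Library.Multiset" "HOL-Computational_Algebra.Polynomial"
begin

text \<open>Modulo \<open>x\<^sub>1(x\<^sub>2x\<^sub>3)\<close> the Leibniz identity makes right multiplications commute, so the left-normed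
  monomials \<open>x\<^sub>i t\<^sup>M\<close> span, where \<open>t\<^sub>j\<close> is right multiplication by \<open>x\<^sub>j\<close> and \<open>M\<close> a multiset of indices.
  In suitable coordinates \<open>(l, m, z)\<close> of the algebra, the first coordinate of the value of
  \<open>x\<^sub>i t\<^sup>M\<close> is \<open>l\<^sub>i z\<^sup>M\<close>, and over an infinite field these functions are linearly independent.

  Over a field with \<open>q\<close> elements, the second generator is \<open>D\<^sub>1\<^sub>2 - D\<^sub>2\<^sub>1\<close> with
  \<open>D\<^sub>i\<^sub>j = x\<^sub>i (t\<^sub>j\<^sup>q - t\<^sub>j)\<close>. Substituting a product for \<open>x\<^sub>1\<close> kills \<open>D\<^sub>2\<^sub>1\<close>, so \<open>t\<^sub>j\<^sup>q\<close> acts as \<open>t\<^sub>j\<close> on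
  products, and what remains is spanned by the monomials with all exponents below \<open>q\<close> and by the
  \<open>D\<^sub>i\<^sub>j\<close> with \<open>i \<le> j\<close>. The first coordinate separates the monomials and vanishes on the \<open>D\<^sub>i\<^sub>j\<close>,
  whose second coordinates \<open>- z\<^sub>i z\<^sub>j\<close> are again linearly independent.\<close>

section \<open>Monomial functions over finite and infinite fields\<close>

text \<open>Multiplication by a nonzero \<open>a\<close> permutes the nonzero elements, so their
  product absorbs one factor \<open>a\<close> for each of them.\<close>

lemma finite_field_power_card:
  fixes a :: "'k::field"
  assumes "finite (UNIV :: 'k set)"
  shows "a ^ card (UNIV :: 'k set) = a"
proof (cases "a = 0")
  case True
  then show ?thesis using assms by (simp add: card_gt_0_iff)
next
  case False
  let ?U = "UNIV - {0 :: 'k}"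
  have fin: "finite ?U" using assms by simp
  have "bij_betw ((*) a) ?U ?U"
    by (rule bij_betw_byWitness[where f' = "\<lambda>x. x / a"]) (use False in auto)
  then have "(\<Prod>x\<in>?U. a * x) = \<Prod>?U"
    by (rule prod.reindex_bij_betw)
  then have "a ^ card ?U * \<Prod>?U = \<Prod>?U"
    by (simp add: prod.distrib)
  moreover have "\<Prod>?U \<noteq> 0" using fin by simp
  ultimately have "a ^ card ?U = 1" by simp
  moreover have "card (UNIV :: 'k set) = Suc (card ?U)"
    using card_Suc_Diff1[OF assms UNIV_I, of 0] by simp
  ultimately show ?thesis by (simp only: power_Suc mult_1_right)
qed

lemma poly_eq_0_if_all_roots:
  fixes p :: "'k::field poly"
  assumes "infinite (UNIV :: 'k set) \<or> degree p < card (UNIV :: 'k set)"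
    and "\<And>t. poly p t = 0"
  shows "p = 0"
proof (rule ccontr)
  assume "p \<noteq> 0"
  then have "finite {t. poly p t = 0}" "card {t. poly p t = 0} \<le> degree p"
    by (simp_all add: poly_roots_finite card_poly_roots_bound)
  then show False using assms by simp
qed

text \<open>Over an infinite field every multiset qualifies, so one independence lemma serves both
  cases; the \<open>itself\<close> argument names the field.\<close>

definition reduced :: "'k itself \<Rightarrow> 'x multiset \<Rightarrow> bool" where
  "reduced _ M \<longleftrightarrow> infinite (UNIV :: 'k set) \<or> (\<forall>j. count M j < card (UNIV :: 'k set))"

text \<open>Induction on the variables that occur. With all but one fixed, the sum is a polynomial
  in that one with too many roots, so each coefficient vanishes, and a coefficient is a combination
  in fewer variables.\<close>

lemma reduced_monomials_independent:
  fixes c :: "'x multiset \<Rightarrow> 'k::field"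
  assumes "finite A" and "\<And>M. M \<in> A \<Longrightarrow> reduced TYPE('k) M"
    and "\<And>z. (\<Sum>M\<in>A. c M * prod_mset (image_mset z M)) = 0" and "M \<in> A"
  shows "c M = 0"
proof -
  define V where "V = (\<Union>M\<in>A. set_mset M)"
  have "finite V" and "\<forall>M\<in>A. set_mset M \<subseteq> V"
    using \<open>finite A\<close> by (auto simp: V_def)
  then show ?thesis
    using assms
  proof (induction V arbitrary: A c M rule: finite_induct)
    case empty
    then have "A = {{#}}" "M = {#}" by auto
    with empty.prems(4) show ?case by simp
  next
    case (insert v V)
    note [simp] = \<open>finite A\<close>
    \<comment> \<open>Only the coefficient of \<open>t ^ k\<close> is extracted: \<open>B\<close>
      holds its terms and \<open>r\<close> deletes \<open>v\<close> from them. On \<open>B\<close>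
      exactly \<open>k\<close> copies of \<open>v\<close> are lost, so \<open>r\<close> is injective
      there.\<close>
    define k where "k = count M v"
    define B where "B = {N \<in> A. count N v = k}"
    define r where "r = (\<lambda>N :: 'x multiset. filter_mset (\<lambda>x. x \<noteq> v) N)"
    have split: "r N + replicate_mset (count N v) v = N" for N
      by (rule multiset_eqI) (simp add: r_def)
    have inj: "inj_on r B"
    proof (rule inj_onI)
      fix N N'
      assume "N \<in> B" "N' \<in> B" "r N = r N'"
      then show "N = N'"
        using split[of N] split[of N'] by (simp add: B_def)
    qed
    have "(\<Sum>N\<in>B. c N * prod_mset (image_mset z (r N))) = 0" for z
    proof -
      define p where "p = (\<Sum>N\<in>A. monom (c N * prod_mset (image_mset z (r N))) (count N v))"
      have "poly p t = 0" for t
      proof -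
        have "prod_mset (image_mset (z(v := t)) N) = prod_mset (image_mset z (r N)) * t ^ count N v" for N
        proof -
          have "image_mset (z(v := t)) (r N) = image_mset z (r N)"
            by (intro image_mset_cong) (simp add: r_def)
          then show ?thesis
            by (subst split[of N, symmetric]) simp
        qed
        then have "poly p t = (\<Sum>N\<in>A. c N * prod_mset (image_mset (z(v := t)) N))"
          by (simp only: p_def poly_sum poly_monom mult.assoc)
        also have "\<dots> = 0" by (rule insert.prems(4))
        finally show ?thesis .
      qed
      moreover have "infinite (UNIV :: 'k set) \<or> degree p < card (UNIV :: 'k set)"
      proof (cases "finite (UNIV :: 'k set)")
        case True
        then have "count N v < card (UNIV :: 'k set)" if "N \<in> A" for N
          using insert.prems(3)[OF that] by (simp add: reduced_def)
        then have "degree p < card (UNIV :: 'k set)"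
          unfolding p_def using True
          by (intro degree_sum_less) (auto simp: card_gt_0_iff intro: le_less_trans[OF degree_monom_le])
        then show ?thesis ..
      qed simp
      ultimately have "p = 0"
        by (intro poly_eq_0_if_all_roots)
      have "(\<Sum>N\<in>B. c N * prod_mset (image_mset z (r N))) = coeff p k"
        by (simp add: p_def B_def coeff_sum coeff_monom sum.inter_filter)
      then show ?thesis using \<open>p = 0\<close> by simp
    qed
    moreover have "r N + replicate_mset k v = N" if "N \<in> B" for N
      using that split[of N] by (simp add: B_def)
    ultimately have "(\<Sum>N\<in>r ` B. c (N + replicate_mset k v) * prod_mset (image_mset z N)) = 0" for z
      by (simp add: sum.reindex[OF inj])
    moreover have "reduced TYPE('k) N" if "N \<in> r ` B" for N
    proof -
      from that obtain N' where "N' \<in> A" "N = r N'" by (auto simp: B_def)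
      with insert.prems(3)[OF \<open>N' \<in> A\<close>] show ?thesis
        by (auto simp: r_def reduced_def)
    qed
    moreover have "\<forall>N\<in>r ` B. set_mset N \<subseteq> V"
      using insert.prems(1) by (auto simp: r_def B_def)
    moreover have "finite (r ` B)" "r M \<in> r ` B"
      using insert.prems(5) by (auto simp: B_def k_def)
    \<comment> \<open>The induction hypothesis is applied to coefficients shifted by the deleted
      copies of \<open>v\<close>.\<close>
    ultimately have "c (r M + replicate_mset k v) = 0"
      by (intro insert.IH[where A = "r ` B" and c = "\<lambda>N. c (N + replicate_mset k v)"]) auto
    then show ?case
      unfolding k_def split[of M] .
  qed
qed

section \<open>Substitutions and T-ideals\<close>

context leibniz_algebra
begin

lemma fl_eval_diff:
  "fl_eval scale mult \<phi> (f - g) = fl_eval scale mult \<phi> f - fl_eval scale mult \<phi> g"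
  using fl_eval_add[of \<phi> "f - g" g] by simp

lemma fl_eval_zero: "fl_eval scale mult \<phi> 0 = 0"
  using fl_eval_diff[of \<phi> 0 0] by simp

lemma fl_eval_sum: "fl_eval scale mult \<phi> (sum F A) = (\<Sum>a\<in>A. fl_eval scale mult \<phi> (F a))"
  by (induction A rule: infinite_finite_induct) (simp_all add: fl_eval_zero fl_eval_add)

lemma fl_eval_rmult_pow:
  "fl_eval scale mult \<phi> (rmult_pow f g n) =
   ((\<lambda>h. mult h (fl_eval scale mult \<phi> g)) ^^ n) (fl_eval scale mult \<phi> f)"
  by (induction n) (simp_all add: rmult_pow_def fl_eval_mult)

text \<open>An endomorphism followed by a substitution is again a homomorphism to the algebra, hence
  the substitution given by its values on the variables.\<close>

lemma algebra_hom_fl_eval_comp: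
  assumes "algebra_hom fl_scale (*) fl_scale (*) h"
  shows "fl_eval scale mult \<phi> (h f) = fl_eval scale mult (\<lambda>i. fl_eval scale mult \<phi> (h (var i))) f"
proof -
  have "algebra_hom fl_scale (*) scale mult (fl_eval scale mult \<phi> \<circ> h)"
    using assms fl_eval_hom[of \<phi>] unfolding algebra_hom_def
    by (auto simp: Vector_Spaces.linear_compose[of fl_scale fl_scale h])
  from fl_eval_unique[OF this refl, of f] show ?thesis by (simp only: o_apply)
qed

lemma T_ideal_T_of: "T_ideal (T_of scale mult)"
  unfolding T_ideal_def
proof (intro conjI allI impI subsetI)
  show "fl.ideal (T_of scale mult)"
    by (simp add: fl.ideal_def fl.subspace_def T_of_def fl_eval_zero fl_eval_add fl_eval_scale
        fl_eval_mult mult_zero_left mult_zero_right)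
next
  fix h g
  assume h: "algebra_hom fl_scale (*) fl_scale (*) h" and "g \<in> h ` T_of scale mult"
  then obtain f where "f \<in> T_of scale mult" "g = h f" by blast
  moreover have "fl_eval scale mult \<phi> (h f) = fl_eval scale mult (\<lambda>i. fl_eval scale mult \<phi> (h (var i))) f"
    for \<phi>
    by (rule algebra_hom_fl_eval_comp[OF h])
  ultimately show "g \<in> T_of scale mult"
    by (simp add: T_of_def)
qed

end

text \<open>Allows a T-ideal containing the generators to be replaced by its part inside
  \<open>T_of scale mult\<close>, where all evaluations vanish.\<close>

lemma T_ideal_Int:
  assumes "T_ideal I" "T_ideal J"
  shows "T_ideal (I \<inter> J)"
  using assms by (simp add: T_ideal_def fl.ideal_def fl.subspace_inter image_subset_iff)

text \<open>Choosing one preimage per vector lets the coefficients be indexed by \<open>S\<close>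
  even when \<open>f\<close> identifies elements.\<close>

lemma (in vector_space) span_image_explicit:
  assumes "x \<in> span (f ` S)"
  obtains A c where "finite A" "A \<subseteq> S" "x = (\<Sum>a\<in>A. scale (c a) (f a))"
proof -
  from assms obtain B r where B: "finite B" "B \<subseteq> f ` S" "x = (\<Sum>b\<in>B. scale (r b) b)"
    unfolding span_explicit by blast
  from B(1,2) obtain A where A: "A \<subseteq> S" "inj_on f A" "B = f ` A"
    by (meson subset_image_inj)
  show ?thesis
  proof (rule that[of A "\<lambda>a. r (f a)"])
    show "finite A" using A B(1) by (simp add: finite_image_iff)
    show "x = (\<Sum>a\<in>A. scale (r (f a)) (f a))"
      using A B(3) by (simp add: sum.reindex)
  qed (fact A(1))
qed

lemma fl_magma_spans: "fl.span (range (magma_eval (*) var)) = (UNIV :: 'k::field free_leibniz set)"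
proof -
  have "f \<in> fl.span (range (magma_eval (*) var))" for f :: "'k free_leibniz"
  proof -
    have "algebra_hom fl_scale (*) fl_scale (*) (\<lambda>f :: 'k free_leibniz. f)"
      by (simp add: algebra_hom_def fl.linear_ident)
    from fl_eval_unique[OF this, of var f] have "f = fl_eval fl_scale (*) var f" by simp
    then have "f = (\<Sum>u\<in>Poly_Mapping.keys (rep_free_leibniz f).
        fl_scale (Poly_Mapping.lookup (rep_free_leibniz f) u) (magma_eval (*) var u))"
      by (simp only: fl_eval_def na_eval_def)
    also have "\<dots> \<in> fl.span (range (magma_eval (*) var))"
      by (intro fl.span_sum fl.span_scale fl.span_base) simp
    finally show ?thesis .
  qed
  then show ?thesis by blast
qed

section \<open>Left-normed normal forms modulo the first generator\<close>

text \<open>Sorting picks one order; modulo the T-ideals considered below, right factors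
  commute.\<close>

definition rmono :: "nat \<Rightarrow> nat multiset \<Rightarrow> 'k::field free_leibniz" where
  "rmono i M = foldl (\<lambda>f j. f * var j) (var i) (sorted_list_of_multiset M)"

lemma rmono_empty: "rmono i {#} = var i"
  by (simp add: rmono_def)

lemma rmono_single: "rmono i {#j#} = var i * var j"
  by (simp add: rmono_def)

locale right_null_T_ideal =
  fixes J :: "'k::field free_leibniz set"
  assumes T_ideal: "T_ideal J"
    and gen: "var 0 * (var 1 * var 2) \<in> J"
begin

lemma subspace: "fl.subspace J"
  using T_ideal by (simp add: T_ideal_def fl.ideal_def)

lemma mult_left: "f \<in> J \<Longrightarrow> g * f \<in> J" and mult_right: "f \<in> J \<Longrightarrow> f * g \<in> J"
  using T_ideal by (simp_all add: T_ideal_def fl.ideal_def)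

lemma subst: "f \<in> J \<Longrightarrow> fl_eval fl_scale (*) \<phi> f \<in> J"
  using T_ideal fl.fl_eval_hom[of \<phi>] unfolding T_ideal_def by blast

lemma right_null: "f * (g * h) \<in> J"
  using subst[OF gen, of "(\<lambda>_. h)(0 := f, 1 := g)"]
  by (simp add: fl.fl_eval_mult fl.fl_eval_var)

definition cong :: "'k free_leibniz \<Rightarrow> 'k free_leibniz \<Rightarrow> bool" (infix "\<approx>" 50) where
  "f \<approx> g \<longleftrightarrow> f - g \<in> J"

lemma cong_refl: "f \<approx> f"
  by (simp add: cong_def fl.subspace_0[OF subspace])

lemma cong_sym: "f \<approx> g \<Longrightarrow> g \<approx> f"
  using fl.subspace_neg[OF subspace, of "f - g"] by (simp add: cong_def)

lemma cong_trans [trans]: "f \<approx> g \<Longrightarrow> g \<approx> h \<Longrightarrow> f \<approx> h"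
  using fl.subspace_add[OF subspace, of "f - g" "g - h"] by (simp add: cong_def)

lemma cong_mult_right: "f \<approx> g \<Longrightarrow> f * h \<approx> g * h"
  using mult_right[of "f - g" h] by (simp add: cong_def fl.mult_diff_left)

text \<open>By the Leibniz identity the difference of the two sides is
  \<open>f * (g * h)\<close>.\<close>

lemma right_comm: "f * g * h \<approx> f * h * g"
  using right_null[of f g h] by (simp add: cong_def fl.leibniz)

lemma foldl_cong: "f \<approx> g \<Longrightarrow> foldl (\<lambda>f j. f * var j) f xs \<approx> foldl (\<lambda>f j. f * var j) g xs"
  by (induction xs arbitrary: f g) (simp_all add: cong_mult_right)

lemma foldl_move: "foldl (\<lambda>f j. f * var j) (f * g) xs \<approx> foldl (\<lambda>f j. f * var j) f xs * g"
proof (induction xs arbitrary: f)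
  case (Cons x xs)
  have "foldl (\<lambda>f j. f * var j) (f * g * var x) xs \<approx> foldl (\<lambda>f j. f * var j) (f * var x * g) xs"
    by (intro foldl_cong right_comm)
  also have "\<dots> \<approx> foldl (\<lambda>f j. f * var j) (f * var x) xs * g"
    by (rule Cons.IH)
  finally show ?case by simp
qed (simp add: cong_refl)

lemma foldl_insort:
  "foldl (\<lambda>f j. f * var j) f (insort j xs) \<approx> foldl (\<lambda>f j. f * var j) f xs * var j"
proof (induction xs arbitrary: f)
  case (Cons x xs)
  then show ?case
    using foldl_move[of f "var j" "x # xs"] by simp
qed (simp add: cong_refl)

lemma rmono_add_mset: "rmono i (add_mset j M) \<approx> rmono i M * var j"
  by (simp add: rmono_def foldl_insort)

lemma rmono_add_replicate: "rmono i (M + replicate_mset n j) \<approx> rmult_pow (rmono i M) (var j) n"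
proof (induction n)
  case (Suc n)
  have "rmono i (M + replicate_mset (Suc n) j) \<approx> rmono i (M + replicate_mset n j) * var j"
    using rmono_add_mset[of i j "M + replicate_mset n j"] by simp
  also have "\<dots> \<approx> rmult_pow (rmono i M) (var j) (Suc n)"
    using cong_mult_right[OF Suc] by (simp add: rmult_pow_def)
  finally show ?case .
qed (simp add: rmult_pow_def cong_refl)

lemma cong_span:
  assumes "f \<approx> g" "g \<in> fl.span (S \<union> J)"
  shows "f \<in> fl.span (S \<union> J)"
  using fl.span_add[OF fl.span_base[of "f - g" "S \<union> J"] assms(2)] assms(1) by (simp add: cong_def)

abbreviation rmonos :: "'k free_leibniz set" where
  "rmonos \<equiv> range (\<lambda>(i, M). rmono i M)"

lemma span_monos_mult_var:
  assumes "f \<in> fl.span (rmonos \<union> J)"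
  shows "f * var j \<in> fl.span (rmonos \<union> J)"
  using assms
proof (induction rule: fl.span_induct_alt)
  case base
  then show ?case by (simp add: fl.mult_zero_left fl.span_zero)
next
  case (step c f g)
  have "f * var j \<in> fl.span (rmonos \<union> J)"
  proof (cases "f \<in> J")
    case True
    then show ?thesis by (simp add: fl.span_base mult_right)
  next
    case False
    with step obtain i M where "f = rmono i M" by auto
    then show ?thesis
      using cong_span[OF cong_sym[OF rmono_add_mset[of i j M]], of rmonos]
      by (auto intro: fl.span_base)
  qed
  with step show ?case
    by (simp add: fl.mult_add_left fl.mult_scale_left fl.span_add fl.span_scale)
qed

text \<open>Induction on magma monomials: multiplying on the right by a variable stays in the span,
  and a monomial whose right factor is itself a product lies in \<open>J\<close>.\<close>

lemma rmonos_span: "fl.span (rmonos \<union> J) = UNIV"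
proof -
  have "magma_eval (*) var u \<in> fl.span (rmonos \<union> J)" for u
  proof (induction u)
    case (Gen i)
    then show ?case
      by (auto intro!: fl.span_base image_eqI[where x = "(i, {#})"] simp: rmono_empty)
  next
    case (Mul u v)
    then show ?case
      by (cases v) (auto intro: span_monos_mult_var fl.span_base right_null)
  qed
  then have "fl.span (range (magma_eval (*) var)) \<subseteq> fl.span (rmonos \<union> J)"
    by (intro fl.span_minimal fl.subspace_span) blast
  then show ?thesis unfolding fl_magma_spans by blast
qed

end

text \<open>The second generator is \<open>frob_diff q 0 1 - frob_diff q 1 0\<close>.\<close>

definition frob_diff :: "nat \<Rightarrow> nat \<Rightarrow> nat \<Rightarrow> 'k::field free_leibniz" where
  "frob_diff q i j = rmult_pow (var i) (var j) q - var i * var j"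

section \<open>Reduction of exponents modulo both generators\<close>

locale right_null_frobenius_T_ideal = right_null_T_ideal J
  for J :: "'k::field free_leibniz set" +
  fixes q :: nat
  assumes q: "q \<ge> 2"
    and frob: "rmult_pow (var 0) (var 1) q - var 0 * var 1 - rmult_pow (var 1) (var 0) q
      + var 1 * var 0 \<in> J"
begin

lemma frob_subst:
  "rmult_pow f g q - f * g - rmult_pow g f q + g * f \<in> J"
  using subst[OF frob, of "(\<lambda>_. f)(1 := g)"]
  by (simp add: fl.fl_eval_mult fl.fl_eval_var fl.fl_eval_add fl.fl_eval_diff
      fl.fl_eval_rmult_pow) (simp add: rmult_pow_def)

lemma frob_diff_sym: "frob_diff q i j \<approx> frob_diff q j i"
  using frob_subst[of "var i" "var j"] by (simp add: frob_diff_def cong_def algebra_simps)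

lemma rmult_pow_product: "rmult_pow f (g * h) (Suc n) \<in> J"
  by (simp add: rmult_pow_def right_null)

text \<open>With \<open>f * h\<close> in place of the first variable, the two terms that end in
  right multiplication by \<open>f * h\<close> lie in \<open>J\<close>.\<close>

lemma frob_product: "rmult_pow (f * h) g q \<approx> f * h * g"
proof -
  have "rmult_pow g (f * h) q \<in> J"
    using q rmult_pow_product[of g f h "q - 1"] by simp
  moreover have "g * (f * h) \<in> J" by (rule right_null)
  moreover have "rmult_pow (f * h) g q - f * h * g =
      (rmult_pow (f * h) g q - f * h * g - rmult_pow g (f * h) q + g * (f * h))
      + (rmult_pow g (f * h) q - g * (f * h))"
    by simp
  ultimately show ?thesis
    unfolding cong_def using frob_subst[of "f * h" g]
    by (metis fl.subspace_add[OF subspace] fl.subspace_diff[OF subspace])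
qed

lemma rmult_pow_cong: "f \<approx> g \<Longrightarrow> rmult_pow f h n \<approx> rmult_pow g h n"
  by (induction n) (simp_all add: rmult_pow_def cong_mult_right)

text \<open>Nonemptiness of \<open>M\<close> exposes a product, to which \<open>frob_product\<close>
  applies. For empty \<open>M\<close> the two sides differ by \<open>frob_diff q i j\<close> modulo
  \<open>J\<close>.\<close>

lemma rmono_frob:
  assumes "M \<noteq> {#}"
  shows "rmono i (M + replicate_mset q j) \<approx> rmono i (add_mset j M)"
proof -
  obtain k N where M: "M = add_mset k N" using assms by (meson multiset_cases)
  have "rmono i (M + replicate_mset q j) \<approx> rmult_pow (rmono i M) (var j) q"
    by (rule rmono_add_replicate)
  also have "\<dots> \<approx> rmult_pow (rmono i N * var k) (var j) q"
    unfolding M by (intro rmult_pow_cong rmono_add_mset)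
  also have "\<dots> \<approx> rmono i N * var k * var j"
    by (rule frob_product)
  also have "\<dots> \<approx> rmono i M * var j"
    unfolding M by (intro cong_sym[OF cong_mult_right] rmono_add_mset)
  also have "\<dots> \<approx> rmono i (add_mset j M)"
    by (rule cong_sym[OF rmono_add_mset])
  finally show ?thesis .
qed

text \<open>Induction on degree: \<open>q\<close> equal right factors collapse to one while others
  remain; when none remain, a \<open>frob_diff\<close> splits off, whose indices
  \<open>frob_diff_sym\<close> puts in order.\<close>

lemma reduced_span:
  "fl.span ((\<lambda>(i, M). rmono i M) ` {(i, M). \<forall>j. count M j < q}
     \<union> (\<lambda>(i, j). frob_diff q i j) ` {(i, j). i \<le> j} \<union> J) = UNIV"
    (is "fl.span (?S \<union> J) = _")
proof -
  have D: "frob_diff q i j \<in> fl.span (?S \<union> J)" for i j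
  proof (cases "i \<le> j")
    case True
    then show ?thesis by (auto intro!: fl.span_base)
  next
    case False
    then have "frob_diff q j i \<in> fl.span (?S \<union> J)" by (auto intro!: fl.span_base)
    then show ?thesis by (rule cong_span[OF frob_diff_sym])
  qed
  have "rmono i M \<in> fl.span (?S \<union> J)" for i M
  proof (induction M rule: measure_induct_rule[where f = size])
    case (less M)
    show ?case
    proof (cases "\<forall>j. count M j < q")
      case True
      then show ?thesis by (auto intro!: fl.span_base)
    next
      case False
      then obtain j where "q \<le> count M j" by (auto simp: not_less)
      then have "replicate_mset q j \<subseteq># M" by (simp add: count_le_replicate_mset_subset_eq)
      then obtain N where M: "M = N + replicate_mset q j"
        by (metis add.commute subset_mset.add_diff_inverse)
      \<comment> \<open>One copy of \<open>j\<close> replaces \<open>q\<close> of them, so the size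
        drops because \<open>q\<close> is at least 2.\<close>
      then have "rmono i (add_mset j N) \<in> fl.span (?S \<union> J)"
        using q by (intro less) simp
      show ?thesis
      proof (cases "N = {#}")
        case False
        then show ?thesis
          using \<open>rmono i (add_mset j N) \<in> _\<close> cong_span[OF rmono_frob] M by blast
      next
        case True
        then have "frob_diff q i j + rmono i {#j#} \<in> fl.span (?S \<union> J)"
          using \<open>rmono i (add_mset j N) \<in> _\<close> D by (simp add: fl.span_add)
        moreover have "rmono i M \<approx> frob_diff q i j + rmono i {#j#}"
          using rmono_add_replicate[of i "{#}" q j] True
          by (simp add: M frob_diff_def rmono_empty rmono_single)
        ultimately show ?thesis by (rule cong_span[rotated])
      qed
    qed
  qed
  then have "fl.span (rmonos \<union> J) \<subseteq> fl.span (?S \<union> J)"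
    by (intro fl.span_minimal fl.subspace_span) (auto intro: fl.span_base)
  then show ?thesis unfolding rmonos_span by blast
qed

end

section \<open>Coordinates on the algebra and values of monomials\<close>

context leibniz_L13
begin

definition coord :: "'a \<Rightarrow> 'a \<Rightarrow> 'k" where
  "coord = representation {e1, e2, e3}"

lemma coord_add: "coord (u + v) b = coord u b + coord v b"
  and coord_scale: "coord (scale c u) b = c * coord u b"
  and coord_basis: "b \<in> {e1, e2, e3} \<Longrightarrow> coord b = (\<lambda>b'. if b' = b then 1 else 0)"
  unfolding coord_def
  using independent_basis span_basis
  by (simp_all add: representation_add representation_scale representation_basis fun_eq_iff)

lemma basis_neq: "e1 \<noteq> e2" "e2 \<noteq> e1" "e1 \<noteq> e3" "e3 \<noteq> e1" "e2 \<noteq> e3" "e3 \<noteq> e2"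
  using distinct_basis by auto

lemma coord_expand: "v = scale (coord v e1) e1 + scale (coord v e2) e2 + scale (coord v e3) e3"
proof -
  have "(\<Sum>b\<in>{e1, e2, e3}. scale (coord v b) b) = v"
    unfolding coord_def using independent_basis span_basis
    by (intro sum_representation_eq) auto
  then show ?thesis by (simp add: basis_neq add.assoc)
qed

text \<open>In the coordinates \<open>(lam, mu, zeta)\<close>, dual to the basis \<open>e1 + e2, - e2, e3 - e1 - e2\<close>,
  the product reads \<open>(l, m, z) (l', m', z') = (l z', z z', 0)\<close>.\<close>

definition zeta :: "'a \<Rightarrow> 'k" where "zeta v = coord v e3"
definition lam :: "'a \<Rightarrow> 'k" where "lam v = coord v e1 + coord v e3"
definition mu :: "'a \<Rightarrow> 'k" where "mu v = coord v e1 - coord v e2"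

lemma coord_mult:
  "mult u v = scale ((coord u e1 + coord u e3) * coord v e3) e1 + scale (coord u e1 * coord v e3) e2"
proof -
  have "mult u v = mult (scale (coord u e1) e1 + scale (coord u e2) e2 + scale (coord u e3) e3)
      (scale (coord v e1) e1 + scale (coord v e2) e2 + scale (coord v e3) e3)"
    using coord_expand[of u] coord_expand[of v] by (rule arg_cong2)
  also have "\<dots> = scale ((coord u e1 + coord u e3) * coord v e3) e1 + scale (coord u e1 * coord v e3) e2"
    by (simp add: mult_add_left mult_add_right mult_scale_left mult_scale_right
        e11 e12 e13 e21 e22 e23 e31 e32 e33 scale_right_distrib scale_left_distrib
        distrib_left mult.commute add.commute add.left_commute)
  finally show ?thesis .
qed

lemma coord_mult_basis:
  "coord (mult u v) e1 = (coord u e1 + coord u e3) * coord v e3"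
  "coord (mult u v) e2 = coord u e1 * coord v e3"
  "coord (mult u v) e3 = 0"
  by (simp_all add: coord_mult coord_add coord_scale coord_basis basis_neq)

lemma functional_mult:
  "lam (mult u v) = lam u * zeta v" "mu (mult u v) = zeta u * zeta v" "zeta (mult u v) = 0"
  by (simp_all add: lam_def mu_def zeta_def coord_mult_basis algebra_simps)

lemma functional_add:
  "lam (u + v) = lam u + lam v" "mu (u + v) = mu u + mu v" "zeta (u + v) = zeta u + zeta v"
  by (simp_all add: lam_def mu_def zeta_def coord_add)

lemma functional_scale:
  "lam (scale c u) = c * lam u" "mu (scale c u) = c * mu u" "zeta (scale c u) = c * zeta u"
  by (simp_all add: lam_def mu_def zeta_def coord_scale algebra_simps)

lemma functional_zero: "lam 0 = 0" "mu 0 = 0" "zeta 0 = 0"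
  using functional_scale[of 0 0] by simp_all

lemma functional_diff:
  "lam (u - v) = lam u - lam v" "mu (u - v) = mu u - mu v" "zeta (u - v) = zeta u - zeta v"
  using functional_add[of "u - v" v] by simp_all

lemma functional_sum:
  "lam (sum F A) = (\<Sum>a\<in>A. lam (F a))" "mu (sum F A) = (\<Sum>a\<in>A. mu (F a))"
  by (induction A rule: infinite_finite_induct) (simp_all add: functional_zero functional_add)

lemma functional_eq_0: "lam v = 0 \<Longrightarrow> mu v = 0 \<Longrightarrow> zeta v = 0 \<Longrightarrow> v = 0"
  using coord_expand[of v] by (simp add: lam_def mu_def zeta_def)

lemma functional_surj: "\<exists>v. lam v = w \<and> zeta v = z"
  \<comment> \<open>\<open>lam\<close> adds the coordinates at \<open>e1\<close> and
    \<open>e3\<close>, hence the compensation \<open>w - z\<close>.\<close>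
  by (rule exI[of _ "scale (w - z) e1 + scale z e3"])
    (simp add: lam_def zeta_def coord_add coord_scale coord_basis basis_neq)

abbreviation ev :: "(nat \<Rightarrow> 'a) \<Rightarrow> 'k free_leibniz \<Rightarrow> 'a" where
  "ev \<equiv> fl_eval scale mult"

text \<open>\<open>zeta\<close> vanishes on products, and \<open>mu\<close> of a product contains
  \<open>zeta\<close> of its left factor, which is a product once \<open>n\<close> is at least
  2.\<close>

lemma functional_rmult_pow:
  "lam (ev \<phi> (rmult_pow f g n)) = lam (ev \<phi> f) * zeta (ev \<phi> g) ^ n"
  "n \<ge> 2 \<Longrightarrow> mu (ev \<phi> (rmult_pow f g n)) = 0"
  "n \<ge> 1 \<Longrightarrow> zeta (ev \<phi> (rmult_pow f g n)) = 0"
proof -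
  show lam: "lam (ev \<phi> (rmult_pow f g n)) = lam (ev \<phi> f) * zeta (ev \<phi> g) ^ n" for n
    by (induction n) (simp_all add: rmult_pow_def fl_eval_mult functional_mult algebra_simps)
  show zeta: "zeta (ev \<phi> (rmult_pow f g n)) = 0" if "n \<ge> 1" for n
    using that by (cases n) (simp_all add: rmult_pow_def fl_eval_mult functional_mult)
  show "mu (ev \<phi> (rmult_pow f g n)) = 0" if "n \<ge> 2"
  proof -
    from that obtain m where "n = Suc m" "m \<ge> 1" by (cases n) auto
    then show ?thesis
      using zeta[of m] by (simp add: rmult_pow_def fl_eval_mult functional_mult)
  qed
qed

lemma lam_foldl:
  "lam (ev \<phi> (foldl (\<lambda>f j. f * var j) f xs)) =
   lam (ev \<phi> f) * prod_mset (image_mset (\<lambda>j. zeta (\<phi> j)) (mset xs))"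
  by (induction xs arbitrary: f) (simp_all add: fl_eval_mult fl_eval_var functional_mult algebra_simps)

lemma lam_rmono:
  "lam (ev \<phi> (rmono i M)) = lam (\<phi> i) * prod_mset (image_mset (\<lambda>j. zeta (\<phi> j)) M)"
  by (simp add: rmono_def lam_foldl fl_eval_var)

text \<open>Right multiplication by \<open>v\<close> depends on \<open>v\<close> only through
  \<open>zeta v\<close>, which is 0 for a product.\<close>

lemma right_null_in_T_of: "var 0 * (var 1 * var 2) \<in> T_of scale mult"
  by (auto simp: T_of_def fl_eval_mult functional_mult intro!: functional_eq_0)

section \<open>Separation of monomials, and identities over an infinite field\<close>

text \<open>Only \<open>lam\<close> of the values is assumed to vanish: over a finite field the
  monomials are separated from the \<open>frob_diff\<close> part precisely because
  \<open>lam\<close> kills the latter.\<close>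

lemma rmonos_combination_zero:
  fixes c :: "nat \<times> nat multiset \<Rightarrow> 'k"
  assumes "finite A" and "\<And>i M. (i, M) \<in> A \<Longrightarrow> reduced TYPE('k) M"
    and "\<And>\<phi>. lam (ev \<phi> (\<Sum>(i, M)\<in>A. fl_scale (c (i, M)) (rmono i M))) = 0"
  shows "(\<Sum>(i, M)\<in>A. fl_scale (c (i, M)) (rmono i M)) = 0"
proof (rule sum.neutral, clarify)
  fix i M
  assume iM: "(i, M) \<in> A"
  define B where "B = {M. (i, M) \<in> A}"
  have pre: "Pair i ` B = {p \<in> A. fst p = i}" by (auto simp: B_def image_iff)
  have "finite (Pair i ` B)" unfolding pre using assms(1) by simp
  then have "finite B" by (rule finite_imageD) (simp add: inj_on_def)
  moreover have "(\<Sum>M\<in>B. c (i, M) * prod_mset (image_mset z M)) = 0" for z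
  proof -
    \<comment> \<open>Setting \<open>lam\<close> to 0 on all variables but the \<open>i\<close>-th
      kills every monomial with another leading variable, while the \<open>zeta\<close> values stay
      free.\<close>
    define \<phi> where "\<phi> j = (SOME v. lam v = of_bool (j = i) \<and> zeta v = z j)" for j
    have \<phi>: "lam (\<phi> j) = of_bool (j = i)" "zeta (\<phi> j) = z j" for j
      using someI_ex[OF functional_surj[of "of_bool (j = i)" "z j"]] by (simp_all add: \<phi>_def)
    have "0 = (\<Sum>p\<in>A. of_bool (fst p = i) * (c p * prod_mset (image_mset z (snd p))))"
      unfolding assms(3)[of \<phi>, symmetric]
      by (simp add: fl_eval_sum functional_sum case_prod_unfold fl_eval_scale functional_scale
          lam_rmono \<phi> algebra_simps)
    also have "\<dots> = (\<Sum>p\<in>Pair i ` B. c p * prod_mset (image_mset z (snd p)))"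
      unfolding pre using assms(1) by (simp add: sum.inter_filter of_bool_def if_distrib
          if_distribR cong: if_cong)
    finally show ?thesis by (simp add: sum.reindex inj_on_def)
  qed
  moreover have "reduced TYPE('k) M" if "M \<in> B" for M
    using that assms(2) by (auto simp: B_def)
  moreover have "M \<in> B" using iM by (simp add: B_def)
  ultimately have "c (i, M) = 0"
    by (intro reduced_monomials_independent[where A = B and c = "\<lambda>M. c (i, M)"])
  then show "fl_scale (c (i, M)) (rmono i M) = 0" by simp
qed

lemma T_of_zero: "f \<in> T_of scale mult \<Longrightarrow> ev \<phi> f = 0"
  by (simp add: T_of_def)

text \<open>As \<open>J\<close> consists of identities, reducing an identity modulo \<open>J\<close>
  leaves a combination of monomials that still vanishes everywhere, hence is zero.\<close>

lemma T_of_subset_infinite: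
  assumes "infinite (UNIV :: 'k set)" "T_ideal J" "var 0 * (var 1 * var 2) \<in> J" "J \<subseteq> T_of scale mult"
  shows "T_of scale mult \<subseteq> J"
proof
  interpret right_null_T_ideal J by unfold_locales fact+
  fix f
  assume f: "f \<in> T_of scale mult"
  have "f \<in> fl.span (rmonos \<union> J)" unfolding rmonos_span ..
  then obtain g r where fgr: "f = g + r" and "g \<in> fl.span rmonos" and "r \<in> J"
    unfolding fl.span_Un fl.span_eq_iff[THEN iffD2, OF subspace] by blast
  then obtain A c where A: "finite A" "g = (\<Sum>(i, M)\<in>A. fl_scale (c (i, M)) (rmono i M))"
    by (elim fl.span_image_explicit) (simp add: case_prod_unfold)
  have "ev \<phi> g = 0" for \<phi>
    using f \<open>r \<in> J\<close> assms(4) fgr T_of_zero[of f \<phi>] T_of_zero[of r \<phi>] by (auto simp: fl_eval_add)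
  then have "g = 0"
    unfolding A(2) using A(1) assms(1)
    by (intro rmonos_combination_zero) (simp_all add: reduced_def functional_zero)
  with fgr \<open>r \<in> J\<close> show "f \<in> J" by simp
qed

end

section \<open>Identities over a finite field\<close>

locale leibniz_L13_finite_field = leibniz_L13 scale mult e1 e2 e3
  for scale :: "'k::field \<Rightarrow> 'a::ab_group_add \<Rightarrow> 'a" and mult :: "'a \<Rightarrow> 'a \<Rightarrow> 'a"
    and e1 e2 e3 :: 'a +
  fixes q :: nat
  assumes finite_field: "finite (UNIV :: 'k set)" and card_field: "card (UNIV :: 'k set) = q"
begin

lemma q_ge_2: "q \<ge> 2"
  using card_mono[OF finite_field, of "{0, 1}"] by (simp add: card_field)

text \<open>\<open>lam\<close> cancels because \<open>a ^ q = a\<close>; in \<open>mu\<close> the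
  power vanishes as \<open>q\<close> is at least 2, leaving the subtracted product.\<close>

lemma functional_frob_diff:
  "lam (ev \<phi> (frob_diff q i j)) = 0"
  "mu (ev \<phi> (frob_diff q i j)) = - (zeta (\<phi> i) * zeta (\<phi> j))"
  "zeta (ev \<phi> (frob_diff q i j)) = 0"
  using q_ge_2
  by (simp_all add: frob_diff_def fl_eval_diff fl_eval_mult fl_eval_var functional_diff
      functional_mult functional_rmult_pow finite_field_power_card[OF finite_field, unfolded card_field])

lemma frob_in_T_of:
  "rmult_pow (var 0) (var 1) q - var 0 * var 1 - rmult_pow (var 1) (var 0) q + var 1 * var 0
   \<in> T_of scale mult"
proof -
  have "rmult_pow (var 0) (var 1) q - var 0 * var 1 - rmult_pow (var 1) (var 0) q + var 1 * var 0
      = (frob_diff q 0 1 - frob_diff q 1 0 :: 'k free_leibniz)"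
    by (simp add: frob_diff_def)
  moreover have "ev \<phi> (frob_diff q 0 1 - frob_diff q 1 0) = 0" for \<phi>
    by (rule functional_eq_0) (simp_all add: fl_eval_diff functional_diff functional_frob_diff)
  ultimately show ?thesis
    by (simp add: T_of_def)
qed

text \<open>The \<open>mu\<close> values give a quadratic form in the \<open>z i\<close>. For
  \<open>q = 2\<close> its squares are not reduced monomials, so the coefficients are read off from
  0/1 values, which works for every \<open>q\<close>.\<close>

lemma frob_diff_combination_zero:
  fixes d :: "nat \<times> nat \<Rightarrow> 'k"
  assumes "finite B" and "\<And>i j. (i, j) \<in> B \<Longrightarrow> i \<le> j"
    and "\<And>\<phi>. mu (ev \<phi> (\<Sum>(i, j)\<in>B. fl_scale (d (i, j)) (frob_diff q i j))) = 0"
  shows "(\<Sum>(i, j)\<in>B. fl_scale (d (i, j)) (frob_diff q i j)) = 0"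
proof -
  \<comment> \<open>Extension by zero lets the coefficient be asked for at pairs outside
    \<open>B\<close>.\<close>
  define d' where "d' p = (if p \<in> B then d p else 0)" for p
  have form: "(\<Sum>(i, j)\<in>B. d (i, j) * (z i * z j)) = 0" for z
  proof -
    define \<phi> where "\<phi> j = (SOME v. lam v = 0 \<and> zeta v = z j)" for j
    have \<phi>: "zeta (\<phi> j) = z j" for j
      using someI_ex[OF functional_surj[of 0 "z j"]] by (simp add: \<phi>_def)
    show ?thesis
      using assms(3)[of \<phi>]
      by (simp add: fl_eval_sum functional_sum case_prod_unfold fl_eval_scale functional_scale
          functional_frob_diff \<phi> sum_negf)
  qed
  \<comment> \<open>At the indicator function of \<open>V\<close> the form becomes the sum of its
    coefficients over the pairs \<open>i \<le> j\<close> in \<open>V\<close>; singletons and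
    two-element sets then suffice.\<close>
  have indicator: "(\<Sum>(i, j)\<in>C. d' (i, j)) = 0" if "finite V" "C = {(i, j). i \<in> V \<and> j \<in> V \<and> i \<le> j}"
    for V C
  proof -
    have "finite C" unfolding that(2) by (rule finite_subset[of _ "V \<times> V"]) (use that(1) in auto)
    have "(\<Sum>p\<in>C. d' p) = (\<Sum>p\<in>B \<inter> C. d p)"
      using \<open>finite C\<close> by (simp add: d'_def sum.inter_restrict Int_commute[of B])
    also have "\<dots> = (\<Sum>p\<in>B. d p * (of_bool (fst p \<in> V) * of_bool (snd p \<in> V)))"
      using assms(1,2) that(2) by (subst sum.inter_restrict) (auto intro!: sum.cong)
    also have "\<dots> = 0"
      using form[of "\<lambda>i. of_bool (i \<in> V)"] by (simp add: case_prod_unfold)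
    finally show ?thesis by (simp add: case_prod_unfold)
  qed
  have diag: "d' (i, i) = 0" for i
  proof -
    have "{(a, b). a \<in> {i} \<and> b \<in> {i} \<and> a \<le> b} = {(i, i)}" by auto
    with indicator[of "{i}" "{(i, i)}"] show ?thesis by simp
  qed
  have "d' (i, j) = 0" if "i \<le> j" for i j
  proof (cases "i = j")
    case False
    with that have "{(a, b). a \<in> {i, j} \<and> b \<in> {i, j} \<and> a \<le> b} = {(i, i), (i, j), (j, j)}"
      by auto
    with indicator[of "{i, j}" "{(i, i), (i, j), (j, j)}"] False diag show ?thesis by auto
  qed (simp add: diag)
  then have "d (i, j) = 0" if "(i, j) \<in> B" for i j
    using that assms(2)[OF that] by (force simp: d'_def)
  then show ?thesis by (intro sum.neutral) auto
qed

lemma T_of_subset_finite: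
  assumes "T_ideal J" "var 0 * (var 1 * var 2) \<in> J"
    and "rmult_pow (var 0) (var 1) q - var 0 * var 1 - rmult_pow (var 1) (var 0) q + var 1 * var 0 \<in> J"
    and "J \<subseteq> T_of scale mult"
  shows "T_of scale mult \<subseteq> J"
proof
  interpret right_null_frobenius_T_ideal J q
    by unfold_locales (use assms q_ge_2 in auto)
  fix f
  assume f: "f \<in> T_of scale mult"
  let ?M = "{(i :: nat, M). \<forall>j. count M j < q}" and ?D = "{(i :: nat, j). i \<le> j}"
  have "f \<in> fl.span ((\<lambda>(i, M). rmono i M) ` ?M \<union> (\<lambda>(i, j). frob_diff q i j) ` ?D \<union> J)"
    unfolding reduced_span ..
  then obtain g h r where fghr: "f = g + h + r" and "r \<in> J"
    and g: "g \<in> fl.span ((\<lambda>(i, M). rmono i M) ` ?M)"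
    and h: "h \<in> fl.span ((\<lambda>(i, j). frob_diff q i j) ` ?D)"
    unfolding fl.span_Un fl.span_eq_iff[THEN iffD2, OF subspace] by blast
  obtain A c where A: "finite A" "A \<subseteq> ?M" "g = (\<Sum>(i, M)\<in>A. fl_scale (c (i, M)) (rmono i M))"
    using g by (elim fl.span_image_explicit) (simp add: case_prod_unfold)
  obtain B d where B: "finite B" "B \<subseteq> ?D" "h = (\<Sum>(i, j)\<in>B. fl_scale (d (i, j)) (frob_diff q i j))"
    using h by (elim fl.span_image_explicit) (simp add: case_prod_unfold)
  have gh: "ev \<phi> g + ev \<phi> h = 0" for \<phi>
    using f \<open>r \<in> J\<close> assms(4) fghr T_of_zero[of f \<phi>] T_of_zero[of r \<phi>] by (auto simp: fl_eval_add)
  \<comment> \<open>\<open>lam\<close> sees only \<open>g\<close>; once \<open>g = 0\<close>,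
    \<open>mu\<close> forces \<open>h = 0\<close>.\<close>
  have "lam (ev \<phi> h) = 0" for \<phi>
    by (simp add: B(3) fl_eval_sum functional_sum case_prod_unfold fl_eval_scale functional_scale
        functional_frob_diff)
  then have "lam (ev \<phi> g) = 0" for \<phi>
    using arg_cong[OF gh, of lam \<phi>] by (simp add: functional_add functional_zero)
  then have "g = 0"
    unfolding A(3) using A(1,2)
    by (intro rmonos_combination_zero) (auto simp: reduced_def card_field)
  then have "mu (ev \<phi> h) = 0" for \<phi>
    using gh[of \<phi>] by (simp add: fl_eval_zero functional_zero)
  then have "h = 0"
    unfolding B(3) using B(1,2)
    by (intro frob_diff_combination_zero) auto
  with fghr \<open>g = 0\<close> \<open>r \<in> J\<close> show "f \<in> J" by simp
qed

end

section \<open>Generation of the T-ideal of identities in both cases\<close>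

theorem theorem3p21:
  fixes scale :: "'k::field \<Rightarrow> 'a::ab_group_add \<Rightarrow> 'a"
    and mult :: "'a \<Rightarrow> 'a \<Rightarrow> 'a"
    and e1 e2 e3 :: 'a
  assumes "leibniz_L13 scale mult e1 e2 e3"
  shows "(infinite (UNIV :: 'k set) \<longrightarrow>
            T_ideal_generated {var 0 * (var 1 * var 2)} (T_of scale mult)) \<and>
         (\<forall>q. finite (UNIV :: 'k set) \<and> card (UNIV :: 'k set) = q \<longrightarrow>
            T_ideal_generated
              {var 0 * (var 1 * var 2),
               rmult_pow (var 0) (var 1) q - var 0 * var 1 - rmult_pow (var 1) (var 0) q + var 1 * var 0}
              (T_of scale mult))"
proof -
  interpret leibniz_L13 scale mult e1 e2 e3 by fact
  show ?thesis
  proof (intro conjI allI impI)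
    assume inf: "infinite (UNIV :: 'k set)"
    show "T_ideal_generated {var 0 * (var 1 * var 2)} (T_of scale mult)"
      unfolding T_ideal_generated_def
    proof (intro conjI allI impI)
      fix J :: "'k free_leibniz set"
      assume J: "T_ideal J \<and> {var 0 * (var 1 * var 2)} \<subseteq> J"
      \<comment> \<open>The inclusion lemma asks for a T-ideal of identities, so it is applied to
        the intersection, which still contains the generator.\<close>
      have "T_of scale mult \<subseteq> J \<inter> T_of scale mult"
        by (rule T_of_subset_infinite[OF inf])
          (use J right_null_in_T_of T_ideal_T_of T_ideal_Int in auto)
      then show "T_of scale mult \<subseteq> J" by blast
    qed (simp_all del: One_nat_def add: T_ideal_T_of right_null_in_T_of)
  next
    fix q
    assume q: "finite (UNIV :: 'k set) \<and> card (UNIV :: 'k set) = q"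
    then interpret leibniz_L13_finite_field scale mult e1 e2 e3 q
      by unfold_locales simp_all
    let ?F = "rmult_pow (var 0) (var 1) q - var 0 * var 1 - rmult_pow (var 1) (var 0) q
      + var 1 * var 0 :: 'k free_leibniz"
    have frob: "?F \<in> T_of scale mult" by (rule frob_in_T_of)
    show "T_ideal_generated {var 0 * (var 1 * var 2), ?F} (T_of scale mult)"
      unfolding T_ideal_generated_def
    proof (intro conjI allI impI)
      fix J :: "'k free_leibniz set"
      assume J: "T_ideal J \<and> {var 0 * (var 1 * var 2), ?F} \<subseteq> J"
      have "T_of scale mult \<subseteq> J \<inter> T_of scale mult"
        by (rule T_of_subset_finite)
          (use J frob right_null_in_T_of T_ideal_T_of T_ideal_Int in auto)
      then show "T_of scale mult \<subseteq> J" by blast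
    qed (simp_all del: One_nat_def add: T_ideal_T_of right_null_in_T_of frob)
  qed
qed

end
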